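(* Let $G$ be a graph of order $n$ and let $\overline{G}$ denote its complement. Then $b^A_g(G)+b^I_g(\overline{G})=\lfloor n/2\rfloor$.
   Context: The balance game on a finite simple graph $G$ is played by two players, Admirable (A) and Impish (I), who alternately select a not-yet-labeled vertex of $G$ until all vertices are labeled; Admirable labels each vertex she selects by $0$ and Impish labels each vertex he selects by $1$. Each edge receives the sum modulo $2$ of the labels of its endpoints. Let $e_0$ and $e_1$ be the numbers of edges labeled $0$ and $1$ at the end; the discrepancy is $d=e_1-e_0$. Admirable tries to minimize $d$ and Impish tries to maximize $d$. $b^A_g(G)$ (the (A)-start game balance number) is the value of $d$ under optimal play of both players when Admirable moves first, and $b^I_g(G)$ (the (I)-start game balance number) is the value under optimal play when Impish moves first. *)

theory Defs
  imports Complex_Main "HOL-Library.Ramsey"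
begin

record 'a graph =
  verts :: "'a set"
  edges :: "'a set set"

definition finite_simple_graph :: "'a graph \<Rightarrow> bool" where
  "finite_simple_graph G \<longleftrightarrow> finite (verts G) \<and> edges G \<subseteq> [verts G]\<^bsup>2\<^esup>"

definition graph_complement :: "'a graph \<Rightarrow> 'a graph" where
  "graph_complement G = \<lparr>verts = verts G, edges = [verts G]\<^bsup>2\<^esup> - edges G\<rparr>"

datatype player = Admirable | Impish

fun opponent :: "player \<Rightarrow> player" where
  "opponent Admirable = Impish"
| "opponent Impish = Admirable"

fun label_of :: "player \<Rightarrow> nat" where
  "label_of Admirable = 0"
| "label_of Impish = 1"

text \<open>A position of the game is a partial labeling of the vertices; a vertex outside
  its domain is not yet labeled.\<close>

type_synonym 'a labeling = "'a \<rightharpoonup> nat"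

definition edge_label :: "'a labeling \<Rightarrow> 'a set \<Rightarrow> nat" where
  "edge_label f e = (\<Sum>v\<in>e. the (f v)) mod 2"

definition discrepancy :: "'a graph \<Rightarrow> 'a labeling \<Rightarrow> int" where
  "discrepancy G f =
     int (card {e \<in> edges G. edge_label f e = 1}) - int (card {e \<in> edges G. edge_label f e = 0})"

definition unlabeled :: "'a graph \<Rightarrow> 'a labeling \<Rightarrow> 'a set" where
  "unlabeled G f = verts G - dom f"

text \<open>The value of position \<open>f\<close> under optimal play by both sides, with player \<open>p\<close> to move,
  by backward induction. The finiteness disjunct only makes the recursion
  total; it is irrelevant for finite graphs.\<close>

function game_value :: "'a graph \<Rightarrow> player \<Rightarrow> 'a labeling \<Rightarrow> int" where
  "game_value G p f =
     (if unlabeled G f = {} \<or> infinite (unlabeled G f) then discrepancy G f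
      else case p of
        Admirable \<Rightarrow>
          Min ((\<lambda>v. game_value G (opponent p) (f(v \<mapsto> label_of p))) ` unlabeled G f)
      | Impish \<Rightarrow>
          Max ((\<lambda>v. game_value G (opponent p) (f(v \<mapsto> label_of p))) ` unlabeled G f))"
  by pat_completeness auto
termination
  by (relation "measure (\<lambda>(G, p, f). card (unlabeled G f))")
     (auto simp: unlabeled_def intro!: diff_less simp: card_gt_0_iff)

declare game_value.simps [simp del]

definition A_start_game_balance :: "'a graph \<Rightarrow> int" where
  "A_start_game_balance G = game_value G Admirable Map.empty"

definition I_start_game_balance :: "'a graph \<Rightarrow> int" where
  "I_start_game_balance G = game_value G Impish Map.empty"

end

theory Submission
  imports Defs
begin

text \<open>Exchanging the two labels and passing to the complement turns the game on \<open>G\<close> into the game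
  on \<open>graph_complement G\<close> with the players' roles exchanged. Exchanging labels does not affect the
  label of an edge, so the discrepancies of corresponding final positions add up to that of a
  labeled complete graph. With signs \<open>s v = 1\<close> for label \<open>0\<close> and \<open>s v = - 1\<close> for label \<open>1\<close>, an edge
  \<open>{u, v}\<close> contributes \<open>- s u * s v\<close> there, so twice the total is \<open>n - (\<Sum>v. s v)\<^sup>2\<close>. The moves alternate
  starting with Admirable, so the sum of the signs ends up being \<open>0\<close> or \<open>1\<close>, according to the parity
  of \<open>n\<close>.\<close>

definition sign :: "'a labeling \<Rightarrow> 'a \<Rightarrow> int" where
  "sign f v = (if f v = Some 0 then 1 else - 1)"

definition edge_sign :: "'a labeling \<Rightarrow> 'a set \<Rightarrow> int" where
  "edge_sign f e = (if edge_label f e = 1 then 1 else - 1)"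

text \<open>Subtraction on \<open>nat\<close> is truncated, so this exchanges labels only where the
  values are \<open>0\<close> and \<open>1\<close>; every larger value goes to
  \<open>0\<close>.\<close>

definition swap_labels :: "'a labeling \<Rightarrow> 'a labeling" where
  "swap_labels f = (\<lambda>v. map_option (\<lambda>x. 1 - x) (f v))"

lemma dom_swap_labels [simp]: "dom (swap_labels f) = dom f"
  by (auto simp: swap_labels_def dom_def)

lemma swap_labels_upd:
  "swap_labels (f(v \<mapsto> label_of p)) = (swap_labels f)(v \<mapsto> label_of (opponent p))"
  by (cases p) (auto simp: swap_labels_def fun_eq_iff)

lemma discrepancy_eq_sum:
  assumes "finite (edges G)"
  shows "discrepancy G f = (\<Sum>e\<in>edges G. edge_sign f e)"
proof -
  have *: "\<not> edge_label f e = 1 \<longleftrightarrow> edge_label f e = 0" for e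
    by (auto simp: edge_label_def)
  have "(\<Sum>e\<in>edges G. edge_sign f e) =
      (\<Sum>e\<in>{e \<in> edges G. edge_label f e = 1}. 1) + (\<Sum>e\<in>{e \<in> edges G. edge_label f e = 0}. - 1)"
    unfolding edge_sign_def sum.If_cases[OF assms]
    by (intro arg_cong2[where f = "(+)"] sum.cong) (use * in auto)
  then show ?thesis
    by (simp add: discrepancy_def)
qed

lemma edge_sign_doubleton:
  assumes "u \<noteq> v" "f u \<in> {Some 0, Some 1}" "f v \<in> {Some 0, Some 1}"
  shows "edge_sign f {u, v} = - sign f u * sign f v"
  using assms by (auto simp: edge_sign_def edge_label_def sign_def)

text \<open>If the endpoints carry \<open>x\<close> and \<open>y\<close>, the swap turns
  \<open>x + y\<close> into \<open>2 - (x + y)\<close>, which has the same parity.\<close>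

lemma edge_sign_swap_labels:
  assumes "e \<in> [V]\<^bsup>2\<^esup>" "\<And>v. v \<in> V \<Longrightarrow> f v \<in> {Some 0, Some 1}"
  shows "edge_sign (swap_labels f) e = edge_sign f e"
proof -
  obtain u v where e: "e = {u, v}" "u \<noteq> v" "u \<in> V" "v \<in> V"
    using assms(1) by (auto simp: nsets_def card_2_iff)
  have "f u \<in> {Some 0, Some 1}" "f v \<in> {Some 0, Some 1}"
    using e assms(2) by blast+
  then show ?thesis
    using \<open>u \<noteq> v\<close> unfolding \<open>e = {u, v}\<close>
    by (auto simp: edge_sign_def edge_label_def swap_labels_def)
qed

lemma nsets_2_insert:
  assumes "x \<notin> V"
  shows "[insert x V]\<^bsup>2\<^esup> = [V]\<^bsup>2\<^esup> \<union> (\<lambda>v. {x, v}) ` V"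
  using assms by (auto simp: nsets_2_eq insert_commute)

text \<open>The square of the sign sum is the number of vertices plus twice the sum of
  \<open>sign f u * sign f v\<close> over all pairs, and \<open>edge_sign\<close> is the negative of
  that product.\<close>

lemma complete_graph_discrepancy:
  assumes "finite V" "\<And>v. v \<in> V \<Longrightarrow> f v \<in> {Some 0, Some 1}"
  shows "2 * (\<Sum>e\<in>[V]\<^bsup>2\<^esup>. edge_sign f e) = int (card V) - (\<Sum>v\<in>V. sign f v)\<^sup>2"
  using assms
proof (induction rule: finite_induct)
  case empty
  then show ?case by (simp add: nsets_2_eq)
next
  case (insert x V)
  have "(\<Sum>e\<in>[insert x V]\<^bsup>2\<^esup>. edge_sign f e)
      = (\<Sum>e\<in>[V]\<^bsup>2\<^esup>. edge_sign f e) + (\<Sum>e\<in>(\<lambda>v. {x, v}) ` V. edge_sign f e)"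
    unfolding nsets_2_insert[OF insert.hyps(2)]
    using insert.hyps by (intro sum.union_disjoint) (auto simp: finite_imp_finite_nsets nsets_def)
  also have "(\<Sum>e\<in>(\<lambda>v. {x, v}) ` V. edge_sign f e) = (\<Sum>v\<in>V. edge_sign f {x, v})"
    by (subst sum.reindex) (auto simp: inj_on_def doubleton_eq_iff)
  also have "\<dots> = (\<Sum>v\<in>V. - sign f x * sign f v)"
    using insert.hyps insert.prems by (intro sum.cong edge_sign_doubleton refl) auto
  also have "\<dots> = - sign f x * (\<Sum>v\<in>V. sign f v)"
    by (simp only: sum_distrib_left)
  finally have "2 * (\<Sum>e\<in>[insert x V]\<^bsup>2\<^esup>. edge_sign f e)
      = int (card V) - (\<Sum>v\<in>V. sign f v)\<^sup>2 - 2 * sign f x * (\<Sum>v\<in>V. sign f v)"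
    using insert by simp
  \<comment> \<open>When the square is expanded, this term cancels the increase of the cardinality
    by one.\<close>
  moreover have "(sign f x)\<^sup>2 = 1"
    by (simp add: sign_def)
  ultimately show ?case
    using insert.hyps by (simp add: power2_sum algebra_simps)
qed

lemma discrepancy_add_complement:
  assumes "finite_simple_graph G" "\<And>v. v \<in> verts G \<Longrightarrow> f v \<in> {Some 0, Some 1}"
  shows "2 * (discrepancy G f + discrepancy (graph_complement G) (swap_labels f))
    = int (card (verts G)) - (\<Sum>v\<in>verts G. sign f v)\<^sup>2"
proof -
  have fin: "finite (verts G)" and sub: "edges G \<subseteq> [verts G]\<^bsup>2\<^esup>"
    using assms(1) by (auto simp: finite_simple_graph_def)
  have fin2: "finite ([verts G]\<^bsup>2\<^esup>)"
    using fin by (rule finite_imp_finite_nsets)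
  have "discrepancy (graph_complement G) (swap_labels f)
      = (\<Sum>e\<in>[verts G]\<^bsup>2\<^esup> - edges G. edge_sign (swap_labels f) e)"
    using fin2 by (subst discrepancy_eq_sum) (auto simp: graph_complement_def)
  also have "\<dots> = (\<Sum>e\<in>[verts G]\<^bsup>2\<^esup> - edges G. edge_sign f e)"
    using assms(2) by (intro sum.cong edge_sign_swap_labels refl) auto
  finally have "discrepancy G f + discrepancy (graph_complement G) (swap_labels f)
      = (\<Sum>e\<in>[verts G]\<^bsup>2\<^esup>. edge_sign f e)"
    using sum.subset_diff[OF sub fin2, of "edge_sign f"] discrepancy_eq_sum[of G f]
      finite_subset[OF sub fin2] by simp
  then show ?thesis
    using complete_graph_discrepancy[OF fin assms(2)] by simp
qed

text \<open>On \<open>A\<close>, \<open>h\<close> is \<open>g\<close> followed by the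
  order-reversing map sending \<open>y\<close> to \<open>c - y\<close>, so a minimizer of
  \<open>g\<close> is a maximizer of \<open>h\<close>.\<close>

lemma Min_plus_Max_const:
  fixes g h :: "'b \<Rightarrow> 'c::linordered_ab_group_add"
  assumes "finite A" "A \<noteq> {}" "\<And>x. x \<in> A \<Longrightarrow> g x + h x = c"
  shows "Min (g ` A) + Max (h ` A) = c"
proof -
  have h: "h x = c - g x" if "x \<in> A" for x
    using assms(3)[OF that] by (simp add: algebra_simps)
  have "Max (h ` A) = c - Min (g ` A)"
  proof (rule Max_eqI)
    show "y \<le> c - Min (g ` A)" if "y \<in> h ` A" for y
      using that assms(1) by (auto simp: h)
    have "Min (g ` A) \<in> g ` A"
      using assms by (intro Min_in) auto
    then show "c - Min (g ` A) \<in> h ` A"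
      by (auto simp: h image_iff)
  qed (use assms in simp)
  then show ?thesis by simp
qed

text \<open>Generalizing to positions in mid-game makes induction on the number of unlabeled
  vertices possible. The condition on the sign sum is the invariant of alternating play started by
  Admirable: the labels balance when she is to move, and there is one extra \<open>0\<close> when
  Impish is.\<close>

lemma game_value_add_complement:
  assumes "finite_simple_graph G" "dom f \<subseteq> verts G" "ran f \<subseteq> {0, 1}"
    and "(\<Sum>v\<in>dom f. sign f v) = (if p = Admirable then 0 else 1)"
  shows "game_value G p f + game_value (graph_complement G) (opponent p) (swap_labels f)
    = int (card (verts G)) div 2"
  using assms(2-)
proof (induction "card (unlabeled G f)" arbitrary: f p rule: less_induct)
  case less
  let ?H = "graph_complement G"
  let ?g = "\<lambda>v. game_value G (opponent p) (f(v \<mapsto> label_of p))"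
  let ?h = "\<lambda>v. game_value ?H p ((swap_labels f)(v \<mapsto> label_of (opponent p)))"
  have fin: "finite (verts G)"
    using assms(1) by (simp add: finite_simple_graph_def)
  then have finU: "finite (unlabeled G f)"
    by (simp add: unlabeled_def)
  have U: "unlabeled ?H (swap_labels f) = unlabeled G f"
    by (simp add: unlabeled_def graph_complement_def)
  have opp: "opponent (opponent p) = p"
    by (cases p) auto
  show ?case
  proof (cases "unlabeled G f = {}")
    case True
    then have dom: "dom f = verts G"
      using less.prems by (auto simp: unlabeled_def)
    have "f v \<in> {Some 0, Some 1}" if "v \<in> verts G" for v
      using that less.prems(2) unfolding dom[symmetric] by (auto intro: ranI)
    then have "2 * (discrepancy G f + discrepancy ?H (swap_labels f))
        = int (card (verts G)) - (if p = Admirable then 0 else 1)"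
      using discrepancy_add_complement[OF assms(1), of f] less.prems(3) by (simp add: dom)
    \<comment> \<open>The left side above is even, so the subtracted \<open>0\<close> or
      \<open>1\<close> is the remainder of the order modulo 2.\<close>
    then have "discrepancy G f + discrepancy ?H (swap_labels f) = int (card (verts G)) div 2"
      by (auto split: if_splits)
    then show ?thesis
      using True by (simp add: game_value.simps[of _ _ f] game_value.simps[of _ _ "swap_labels f"] U)
  next
    case False
    \<comment> \<open>Both games continue at the same vertex \<open>v\<close>, with opposite players
      and labels, so the new positions are again mirror images and the induction hypothesis
      applies.\<close>
    have step: "?g v + ?h v = int (card (verts G)) div 2" if v: "v \<in> unlabeled G f" for v
    proof -
      let ?f = "f(v \<mapsto> label_of p)"
      have v': "v \<in> verts G" "v \<notin> dom f"
        using v by (auto simp: unlabeled_def)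
      have "unlabeled G ?f \<subset> unlabeled G f"
        using v by (auto simp: unlabeled_def)
      then have "card (unlabeled G ?f) < card (unlabeled G f)"
        using finU by (rule psubset_card_mono[rotated])
      moreover have "dom ?f \<subseteq> verts G"
        using less.prems v' by auto
      moreover have "ran ?f \<subseteq> {0, 1}"
        using less.prems v' by (cases p) (auto simp: ran_def)
      moreover have "(\<Sum>w\<in>dom ?f. sign ?f w) = (if opponent p = Admirable then 0 else 1)"
      proof -
        have "finite (dom f)"
          using less.prems(1) fin by (rule finite_subset)
        then have "(\<Sum>w\<in>dom ?f. sign ?f w) = sign ?f v + (\<Sum>w\<in>dom f. sign ?f w)"
          using v' by simp
        also have "(\<Sum>w\<in>dom f. sign ?f w) = (\<Sum>w\<in>dom f. sign f w)"
          using v' by (intro sum.cong) (auto simp: sign_def)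
        also have "\<dots> = (if p = Admirable then 0 else 1)"
          by (rule less.prems(3))
        also have "sign ?f v = (if p = Admirable then 1 else - 1)"
          by (cases p) (auto simp: sign_def)
        also have "(if p = Admirable then 1 else - 1) + (if p = Admirable then 0 else 1)
            = (if opponent p = Admirable then 0 else 1 :: int)"
          by (cases p) auto
        finally show ?thesis .
      qed
      ultimately have "game_value G (opponent p) ?f
          + game_value ?H (opponent (opponent p)) (swap_labels ?f) = int (card (verts G)) div 2"
        by (rule less.hyps)
      then show ?thesis
        by (simp only: opp swap_labels_upd)
    qed
    show ?thesis
    proof (cases p)
      case Admirable
      then show ?thesis
        using False finU Min_plus_Max_const[OF finU False, of ?g ?h, OF step]
        by (simp add: game_value.simps[of _ _ f] game_value.simps[of _ _ "swap_labels f"] U)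
    next
      case Impish
      \<comment> \<open>Now the maximum is taken in \<open>G\<close> and the minimum in the
        complement, so \<open>?g\<close> and \<open>?h\<close> trade places.\<close>
      have "?h v + ?g v = int (card (verts G)) div 2" if "v \<in> unlabeled G f" for v
        using step[OF that] by simp
      note Min_plus_Max_const[OF finU False, of ?h ?g, OF this]
      then show ?thesis
        using False finU Impish
        by (simp add: game_value.simps[of _ _ f] game_value.simps[of _ _ "swap_labels f"] U)
    qed
  qed
qed

theorem theorem2p2:
  fixes G :: "'a graph" and n :: nat
  assumes "finite_simple_graph G"
    and "card (verts G) = n"
  shows "A_start_game_balance G + I_start_game_balance (graph_complement G) = \<lfloor>real n / 2\<rfloor>"
proof -
  \<comment> \<open>The empty position is its own mirror image, and its sign sum \<open>0\<close>
    fits Admirable moving first.\<close>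
  have "swap_labels Map.empty = (Map.empty :: 'a labeling)"
    by (simp add: swap_labels_def)
  then have "A_start_game_balance G + I_start_game_balance (graph_complement G) = int n div 2"
    using game_value_add_complement[OF assms(1), of Map.empty Admirable] assms(2)
    by (simp add: A_start_game_balance_def I_start_game_balance_def)
  also have "\<dots> = \<lfloor>real n / 2\<rfloor>"
    using floor_divide_of_int_eq[of "int n" 2, where ?'a = real] by simp
  finally show ?thesis .
qed

end
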